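(* Let $(A,[\,])$ be a ternary group. Then $(A,[\,])$ is a knot-theoretic ternary group if and only if $(A,[\,])$ is semi-commutative and satisfies $[abb]=\bar a$ for all $a,b\in A$. In particular, in each knot-theoretic ternary group one has $[ccc]=\bar c$ for every $c\in A$.
   Context: A ternary groupoid $(A,[\,])$ is a non-empty set $A$ with a ternary operation $[\,]\colon A^3\to A$. It is a ternary quasigroup if for all $a,b,c\in A$ each of the equations $[zab]=c$, $[azb]=c$, $[abz]=c$ has a unique solution $z\in A$. A ternary group is a ternary quasigroup that is associative: $[[abc]de]=[a[bcd]e]=[ab[cde]]$ for all $a,b,c,d,e\in A$. In a ternary group, the skew element $\bar a$ of $a$ is the unique solution $z$ of $[aza]=a$. $(A,[\,])$ is semi-commutative if $[abc]=[cba]$ for all $a,b,c\in A$. A knot-theoretic ternary group is a ternary group such that, for all $a,b,c,d\in A$, $[[abc]cd]=[[ab[bcd]][bcd]d]$ and $[ab[bcd]]=[a[abc][[abc]cd]]$. *)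

theory Defs
  imports Main
begin

locale ternary_groupoid =
  fixes A :: "'a set" and t :: "'a \<Rightarrow> 'a \<Rightarrow> 'a \<Rightarrow> 'a"
  assumes nonempty: "A \<noteq> {}"
    and closed: "\<lbrakk>a \<in> A; b \<in> A; c \<in> A\<rbrakk> \<Longrightarrow> t a b c \<in> A"

locale ternary_quasigroup = ternary_groupoid +
  assumes solve_left: "\<lbrakk>a \<in> A; b \<in> A; c \<in> A\<rbrakk> \<Longrightarrow> \<exists>!z. z \<in> A \<and> t z a b = c"
    and solve_middle: "\<lbrakk>a \<in> A; b \<in> A; c \<in> A\<rbrakk> \<Longrightarrow> \<exists>!z. z \<in> A \<and> t a z b = c"
    and solve_right: "\<lbrakk>a \<in> A; b \<in> A; c \<in> A\<rbrakk> \<Longrightarrow> \<exists>!z. z \<in> A \<and> t a b z = c"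

locale ternary_group = ternary_quasigroup +
  assumes assoc_left_middle:
      "\<lbrakk>a \<in> A; b \<in> A; c \<in> A; d \<in> A; e \<in> A\<rbrakk> \<Longrightarrow> t (t a b c) d e = t a (t b c d) e"
    and assoc_middle_right:
      "\<lbrakk>a \<in> A; b \<in> A; c \<in> A; d \<in> A; e \<in> A\<rbrakk> \<Longrightarrow> t a (t b c d) e = t a b (t c d e)"

text \<open>Only meaningful in a ternary quasigroup, where the described element exists uniquely.\<close>

definition skew :: "'a set \<Rightarrow> ('a \<Rightarrow> 'a \<Rightarrow> 'a \<Rightarrow> 'a) \<Rightarrow> 'a \<Rightarrow> 'a" where
  "skew A t a = (THE z. z \<in> A \<and> t a z a = a)"

definition semi_commutative :: "'a set \<Rightarrow> ('a \<Rightarrow> 'a \<Rightarrow> 'a \<Rightarrow> 'a) \<Rightarrow> bool" where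
  "semi_commutative A t \<longleftrightarrow> (\<forall>a\<in>A. \<forall>b\<in>A. \<forall>c\<in>A. t a b c = t c b a)"

locale knot_theoretic_ternary_group = ternary_group +
  assumes knot_left:
      "\<lbrakk>a \<in> A; b \<in> A; c \<in> A; d \<in> A\<rbrakk> \<Longrightarrow>
        t (t a b c) c d = t (t a b (t b c d)) (t b c d) d"
    and knot_right:
      "\<lbrakk>a \<in> A; b \<in> A; c \<in> A; d \<in> A\<rbrakk> \<Longrightarrow>
        t a b (t b c d) = t a (t a b c) (t (t a b c) c d)"

end

theory Submission
  imports Defs
begin

text \<open>In an enveloping group, where the ternary operation becomes the product of three factors,
  both knot-theoretic identities reduce by cancellation to \<open>(bcd)\<^sup>2 = c\<^sup>2\<close>. Taking \<open>b = d\<^sup>-\<^sup>1\<close>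
  shows that squares are central, \<open>b = c = d\<close> gives \<open>c\<^sup>4 = 1\<close>, and \<open>b = c\<close> then gives
  \<open>d\<^sup>2 = c\<^sup>2\<close>: all squares equal one central involution \<open>s\<close>. Hence \<open>abb = as = a\<^sup>3 = a\<^sup>-\<^sup>1\<close>, and
  \<open>abc\<sqdot>cba = s\<^sup>3 = s = (abc)\<^sup>2\<close> gives \<open>abc = cba\<close>. Below, a word of even length is represented
  by its action on an arbitrary left factor.\<close>

context ternary_group
begin

lemma cancel_left:
  "\<lbrakk>a \<in> A; b \<in> A; x \<in> A; y \<in> A; t a b x = t a b y\<rbrakk> \<Longrightarrow> x = y"
  using solve_right[of a b "t a b y"] closed by blast

lemma cancel_middle:
  "\<lbrakk>a \<in> A; b \<in> A; x \<in> A; y \<in> A; t a x b = t a y b\<rbrakk> \<Longrightarrow> x = y"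
  using solve_middle[of a b "t a y b"] closed by blast

lemma skew_closed: "a \<in> A \<Longrightarrow> skew A t a \<in> A"
  and skew_middle: "a \<in> A \<Longrightarrow> t a (skew A t a) a = a"
  using theI'[OF solve_middle[of a a a]] by (simp_all add: skew_def)

lemma skew_unique: "\<lbrakk>a \<in> A; z \<in> A; t a z a = a\<rbrakk> \<Longrightarrow> skew A t a = z"
  using cancel_middle[of a a "skew A t a" z] skew_closed skew_middle by simp

lemma skew_left:
  assumes "a \<in> A" "b \<in> A"
  shows "t a (skew A t a) b = b"
proof -
  \<comment> \<open>Factoring \<open>b\<close> so that it begins with \<open>a\<close> lets the
    defining equation of \<open>skew A t a\<close> act at the front.\<close>
  obtain u where u: "u \<in> A" "t a a u = b"
    using assms solve_right[of a a b] by blast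
  then have "t a (skew A t a) (t a a u) = t (t a (skew A t a) a) a u"
    using assms by (simp add: skew_closed assoc_left_middle assoc_middle_right)
  then show ?thesis
    using assms u by (simp add: skew_middle)
qed

lemma skew_right:
  assumes "a \<in> A" "b \<in> A"
  shows "t b (skew A t a) a = b"
proof -
  have "t a (t b (skew A t a) a) a = t a b (t (skew A t a) a a)"
    using assms by (simp add: skew_closed assoc_middle_right)
  also have "t (skew A t a) a a = a"
  proof (rule cancel_left[of a a])
    show "t a a (t (skew A t a) a a) = t a a a"
      using assms assoc_middle_right[of a a "skew A t a" a a] by (simp add: skew_closed skew_middle)
  qed (use assms in \<open>auto simp: skew_closed closed\<close>)
  finally show ?thesis
    using assms cancel_middle[of a a "t b (skew A t a) a" b] by (simp add: skew_closed closed)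
qed

text \<open>Inserting \<open>skew A t b\<close> and \<open>b\<close> after \<open>x\<close> changes
  nothing, so the action of a square on \<open>b\<close> determines its action on every left
  factor.\<close>

lemma square_act_transfer:
  assumes "b \<in> A" "c \<in> A" "d \<in> A" "x \<in> A" and eq: "t b c c = t b d d"
  shows "t x c c = t x d d"
proof -
  have "t x e e = t x (skew A t b) (t b e e)" if "e \<in> A" for e
    using that assms skew_right[of b x]
      assoc_left_middle[of x "skew A t b" b e e] assoc_middle_right[of x "skew A t b" b e e]
    by (simp add: skew_closed)
  then show ?thesis
    using assms by simp
qed

end

context knot_theoretic_ternary_group
begin

text \<open>With equal first two arguments, the left knot identity can be cancelled down to two
  squares acting on \<open>b\<close>.\<close>

lemma square_of_product:
  assumes "x \<in> A" "b \<in> A" "c \<in> A" "d \<in> A"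
  shows "t x c c = t x (t b c d) (t b c d)"
proof (rule square_act_transfer[of b])
  let ?y = "t b c d"
  have "t b (t b c c) d = t b (t b ?y ?y) d"
    using assms knot_left[of b b c d] by (simp add: closed assoc_left_middle)
  then show "t b c c = t b ?y ?y"
    using assms cancel_middle[of b d "t b c c" "t b ?y ?y"] by (simp add: closed)
qed (use assms in \<open>auto simp: closed\<close>)

lemma square_central:
  assumes "c \<in> A" "d \<in> A"
  shows "t c c d = t d c c"
proof -
  let ?e = "skew A t d"
  \<comment> \<open>Since \<open>?e\<close> acts as the inverse of \<open>d\<close>, this is the
    conjugate of \<open>c\<close> by \<open>d\<close>.\<close>
  let ?y = "t ?e c d"
  have e: "?e \<in> A" using assms by (simp add: skew_closed)
  have "t d c c = t d ?y ?y"
    using assms e square_of_product by blast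
  also have "\<dots> = t (t d ?e c) d (t ?e c d)"
    using assms e by (simp add: closed assoc_left_middle)
  also have "\<dots> = t c (t d ?e c) d"
    using assms e assoc_middle_right[of c d ?e c d] by (simp add: skew_left)
  also have "\<dots> = t c c d"
    using assms by (simp add: skew_left)
  finally show ?thesis by simp
qed

lemma square_involution:
  assumes "x \<in> A" "c \<in> A"
  shows "t (t x c c) c c = x"
proof -
  have *: "t u c c = t (t (t u c c) c c) c c" if "u \<in> A" for u
  proof -
    have "t u c c = t u (t c c c) (t c c c)"
      using that assms square_of_product by blast
    also have "\<dots> = t (t (t u c c) c c) c c"
      using that assms by (simp add: closed assoc_left_middle assoc_middle_right)
    finally show ?thesis .
  qed
  \<comment> \<open>By \<open>*\<close>, the square and the sixth power of \<open>c\<close> act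
    alike. Applying this to \<open>x\<close> divided by the square of \<open>c\<close> leaves the
    fourth power.\<close>
  let ?x = "t x (skew A t c) (skew A t c)"
  have x: "t ?x c c = x"
    using assms assoc_left_middle[of x "skew A t c" "skew A t c" c c]
      assoc_middle_right[of x "skew A t c" "skew A t c" c c] skew_right[of c "skew A t c"]
    by (simp add: skew_closed skew_right)
  have "t ?x c c = t (t (t ?x c c) c c) c c"
    using assms by (intro *) (simp add: closed skew_closed)
  then show ?thesis
    by (simp only: x)
qed

lemma squares_agree:
  assumes "x \<in> A" "c \<in> A" "d \<in> A"
  shows "t x d d = t x c c"
proof -
  \<comment> \<open>Centrality rewrites one factor \<open>t c c d\<close> so that the four copies of
    \<open>c\<close> meet and cancel.\<close>
  have "t x c c = t x (t d c c) (t c c d)"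
    using assms square_of_product[of x c c d] square_central[of c d] by simp
  also have "\<dots> = t x (t (t d c c) c c) d"
    using assms by (simp add: closed assoc_middle_right)
  also have "\<dots> = t x d d"
    using assms by (simp add: square_involution)
  finally show ?thesis by simp
qed

lemma square_act_eq_skew:
  assumes "a \<in> A" "b \<in> A"
  shows "t a b b = skew A t a"
proof -
  have "t a (t a a a) a = a"
    using assms square_involution[of a a] by (simp add: assoc_left_middle)
  then have "skew A t a = t a a a"
    using assms by (simp add: skew_unique closed)
  then show ?thesis
    using assms squares_agree[of a a b] by simp
qed

lemma semi_commutative: "semi_commutative A t"
  unfolding semi_commutative_def
proof (intro ballI)
  fix a b c assume abc: "a \<in> A" "b \<in> A" "c \<in> A"
  let ?y = "t a b c"
  have y: "?y \<in> A" using abc by (simp add: closed)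
  \<comment> \<open>The reversed word collapses from the inside: \<open>b c c b\<close> becomes a
    fourth power and disappears, leaving the square of \<open>a\<close>, which acts like that of
    \<open>?y\<close>.\<close>
  have "t a ?y (t c b a) = t a a (t (t b c c) b a)"
    using abc by (simp add: closed assoc_left_middle assoc_middle_right)
  also have "t b c c = t b b b"
    using abc squares_agree by blast
  also have "t (t b b b) b a = t b b (t b b a)"
    using abc by (simp add: assoc_left_middle assoc_middle_right)
  also have "\<dots> = a"
    using abc square_central[of b a] square_central[of b "t a b b"]
    by (simp add: closed square_involution)
  also have "t a a a = t a ?y ?y"
    using abc y squares_agree by blast
  finally have "t a ?y ?y = t a ?y (t c b a)" by simp
  then show "?y = t c b a"
    using abc y cancel_left[of a ?y ?y "t c b a"] by (simp add: closed)
qed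

end

lemma (in ternary_group) knot_theoretic_if_semi_commutative:
  assumes "semi_commutative A t" and square: "\<And>a b. \<lbrakk>a \<in> A; b \<in> A\<rbrakk> \<Longrightarrow> t a b b = skew A t a"
  shows "knot_theoretic_ternary_group A t"
proof
  have comm: "t a b c = t c b a" if "a \<in> A" "b \<in> A" "c \<in> A" for a b c
    using assms(1) that by (simp add: semi_commutative_def)
  fix a b c d assume abcd: "a \<in> A" "b \<in> A" "c \<in> A" "d \<in> A"
  show "t (t a b c) c d = t (t a b (t b c d)) (t b c d) d"
    \<comment> \<open>After reassociation, both inner squares turn \<open>b\<close> into its skew
      element.\<close>
    using abcd by (simp add: closed assoc_left_middle square)
  let ?y = "t a b c"
  have y: "?y \<in> A" using abcd by (simp add: closed)
  have "t a b (t b c d) = t a (t b b c) d"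
    using abcd by (simp add: assoc_middle_right)
  \<comment> \<open>Semi-commutativity moves each square to the right of \<open>c\<close>, where
    both give \<open>skew A t c\<close>.\<close>
  also have "t b b c = t ?y ?y c"
    using abcd y comm[of b b c] comm[of ?y ?y c] by (simp add: square)
  also have "t a (t ?y ?y c) d = t a ?y (t ?y c d)"
    using abcd y assoc_middle_right[of a ?y ?y c d] by simp
  finally show "t a b (t b c d) = t a ?y (t ?y c d)" .
qed

theorem corollary2p11:
  fixes A :: "'a set" and t :: "'a \<Rightarrow> 'a \<Rightarrow> 'a \<Rightarrow> 'a"
  assumes "ternary_group A t"
  shows "(knot_theoretic_ternary_group A t \<longleftrightarrow>
            semi_commutative A t \<and> (\<forall>a\<in>A. \<forall>b\<in>A. t a b b = skew A t a)) \<and>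
         (knot_theoretic_ternary_group A t \<longrightarrow> (\<forall>c\<in>A. t c c c = skew A t c))"
proof (intro conjI iffI impI ballI)
  assume "knot_theoretic_ternary_group A t"
  then interpret knot_theoretic_ternary_group A t .
  show "semi_commutative A t" by (rule semi_commutative)
  show "t a b b = skew A t a" if "a \<in> A" "b \<in> A" for a b
    using that by (rule square_act_eq_skew)
  show "t c c c = skew A t c" if "c \<in> A" for c
    using that that by (rule square_act_eq_skew)
next
  assume "semi_commutative A t \<and> (\<forall>a\<in>A. \<forall>b\<in>A. t a b b = skew A t a)"
  then show "knot_theoretic_ternary_group A t"
    using ternary_group.knot_theoretic_if_semi_commutative[OF assms] by simp
qed

end
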